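(* Suppose $S$ and $T$ are strongly Morita equivalent inverse monoids. Then their centers are isomorphic: $Z(S)\cong Z(T)$.
   Context: An inverse semigroup is a semigroup $S$ such that for each $s\in S$ there is a unique $s^*\in S$ with $ss^*s=s$ and $s^*ss^*=s^*$; an inverse monoid is an inverse semigroup with identity. $Z(S)=\{z\in S\mid zs=sz\text{ for all }s\in S\}$. A Morita context is a 5-tuple $(S,T,X,\langle\ ,\ \rangle,[\ ,\ ])$ where $S,T$ are inverse semigroups, $X$ is a set with a left action of $S$ and a right action of $T$ (as semigroups) that commute, and $\langle\ ,\ \rangle\colon X\times X\to S$, $[\ ,\ ]\colon X\times X\to T$ are surjective functions such that for all $x,y,z\in X$, $s\in S$, $t\in T$: (1) $\langle sx,y\rangle=s\langle x,y\rangle$; (2) $\langle y,x\rangle=\langle x,y\rangle^*$; (3) $\langle x,x\rangle x=x$; (4) $[x,yt]=[x,y]t$; (5) $[y,x]=[x,y]^*$; (6) $x[x,x]=x$; (7) $\langle x,y\rangle z=x[y,z]$. $S$ and $T$ are strongly Morita equivalent if such a Morita context exists. *)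

theory Defs
  imports "HOL-Algebra.Group"
begin

text \<open>
  Semigroups are represented by the records of the theory of groups; \<open>inverse_semigroup\<close> and
  \<open>morita_context\<close> put no condition on the field \<open>one\<close>, which matters only for \<open>inverse_monoid\<close>.
\<close>

locale inverse_semigroup =
  fixes S (structure)
  assumes sg_closed: "\<lbrakk>a \<in> carrier S; b \<in> carrier S\<rbrakk> \<Longrightarrow> a \<otimes> b \<in> carrier S"
    and sg_assoc: "\<lbrakk>a \<in> carrier S; b \<in> carrier S; c \<in> carrier S\<rbrakk>
      \<Longrightarrow> (a \<otimes> b) \<otimes> c = a \<otimes> (b \<otimes> c)"
    and sg_inv_ex1: "a \<in> carrier S
      \<Longrightarrow> \<exists>!b. b \<in> carrier S \<and> a \<otimes> b \<otimes> a = a \<and> b \<otimes> a \<otimes> b = b"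

locale inverse_monoid = inverse_semigroup S + monoid S for S (structure)

text \<open>The semigroup inverse \<open>a\<^sup>*\<close>; it is not \<^const>\<open>m_inv\<close>, which is the two-sided inverse of a unit.\<close>

definition sg_inv :: "('a, 'm) monoid_scheme \<Rightarrow> 'a \<Rightarrow> 'a" where
  "sg_inv S a = (THE b. b \<in> carrier S \<and> a \<otimes>\<^bsub>S\<^esub> b \<otimes>\<^bsub>S\<^esub> a = a \<and> b \<otimes>\<^bsub>S\<^esub> a \<otimes>\<^bsub>S\<^esub> b = b)"

definition center :: "('a, 'm) monoid_scheme \<Rightarrow> 'a set" where
  "center S = {z \<in> carrier S. \<forall>s \<in> carrier S. z \<otimes>\<^bsub>S\<^esub> s = s \<otimes>\<^bsub>S\<^esub> z}"

locale morita_context = S: inverse_semigroup S + T: inverse_semigroup T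
  for S :: "('a, 'm) monoid_scheme" and T :: "('b, 'n) monoid_scheme" +
  fixes X :: "'x set"
    and lact :: "'a \<Rightarrow> 'x \<Rightarrow> 'x"
    and ract :: "'x \<Rightarrow> 'b \<Rightarrow> 'x"
    and lform :: "'x \<Rightarrow> 'x \<Rightarrow> 'a"
    and rform :: "'x \<Rightarrow> 'x \<Rightarrow> 'b"
  assumes lact_closed: "\<lbrakk>s \<in> carrier S; x \<in> X\<rbrakk> \<Longrightarrow> lact s x \<in> X"
    and lact_mult: "\<lbrakk>s \<in> carrier S; s' \<in> carrier S; x \<in> X\<rbrakk>
      \<Longrightarrow> lact (s \<otimes>\<^bsub>S\<^esub> s') x = lact s (lact s' x)"
    and ract_closed: "\<lbrakk>x \<in> X; t \<in> carrier T\<rbrakk> \<Longrightarrow> ract x t \<in> X"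
    and ract_mult: "\<lbrakk>x \<in> X; t \<in> carrier T; t' \<in> carrier T\<rbrakk>
      \<Longrightarrow> ract x (t \<otimes>\<^bsub>T\<^esub> t') = ract (ract x t) t'"
    and acts_commute: "\<lbrakk>s \<in> carrier S; x \<in> X; t \<in> carrier T\<rbrakk>
      \<Longrightarrow> ract (lact s x) t = lact s (ract x t)"
    and lform_surj: "(\<lambda>(x, y). lform x y) ` (X \<times> X) = carrier S"
    and rform_surj: "(\<lambda>(x, y). rform x y) ` (X \<times> X) = carrier T"
    and lform_lact: "\<lbrakk>s \<in> carrier S; x \<in> X; y \<in> X\<rbrakk>
      \<Longrightarrow> lform (lact s x) y = s \<otimes>\<^bsub>S\<^esub> lform x y"
    and lform_swap: "\<lbrakk>x \<in> X; y \<in> X\<rbrakk> \<Longrightarrow> lform y x = sg_inv S (lform x y)"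
    and lform_self: "x \<in> X \<Longrightarrow> lact (lform x x) x = x"
    and rform_ract: "\<lbrakk>x \<in> X; y \<in> X; t \<in> carrier T\<rbrakk>
      \<Longrightarrow> rform x (ract y t) = rform x y \<otimes>\<^bsub>T\<^esub> t"
    and rform_swap: "\<lbrakk>x \<in> X; y \<in> X\<rbrakk> \<Longrightarrow> rform y x = sg_inv T (rform x y)"
    and rform_self: "x \<in> X \<Longrightarrow> ract x (rform x x) = x"
    and forms_compat: "\<lbrakk>x \<in> X; y \<in> X; z \<in> X\<rbrakk> \<Longrightarrow> lact (lform x y) z = ract x (rform y z)"

text \<open>
  HOL cannot quantify over types inside a formula, so the type in which the set of a Morita context
  lives is an explicit argument. A theorem with the hypothesis
  \<open>strongly_morita_equivalent TYPE('x) S T\<close> for a type variable \<open>'x\<close> holds for Morita contexts over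
  every type.
\<close>

definition strongly_morita_equivalent ::
  "'x itself \<Rightarrow> ('a, 'm) monoid_scheme \<Rightarrow> ('b, 'n) monoid_scheme \<Rightarrow> bool" where
  "strongly_morita_equivalent _ S T \<longleftrightarrow>
    (\<exists>(X :: 'x set) lact ract lform rform. morita_context S T X lact ract lform rform)"

end

theory Submission
  imports Defs
begin

text \<open>
  Call \<open>z \<in> S\<close> and \<open>t \<in> T\<close> matched if \<open>z x = x t\<close> for all \<open>x \<in> X\<close>. As both actions are faithful,
  matching is one-to-one, and it is compatible with products. Writing \<open>1 = [p, q]\<close> in \<open>T\<close>, a central
  \<open>z\<close> is matched with \<open>[p, z q]\<close>, because \<open>x [p, z q] = \<langle>x, p\<rangle> z q = z \<langle>x, p\<rangle> q = z x [p, q]\<close>; dually,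
  writing \<open>1 = \<langle>a, b\<rangle>\<close> in \<open>S\<close>, a central \<open>t\<close> is matched with \<open>\<langle>a t, b\<rangle>\<close>.
\<close>

locale monoid_morita_context = morita_context S T X lact ract lform rform + S: monoid S + T: monoid T
  for S :: "('a, 'm) monoid_scheme" and T :: "('b, 'n) monoid_scheme" and X :: "'x set"
    and lact ract lform rform
begin

lemma lform_closed: "x \<in> X \<Longrightarrow> y \<in> X \<Longrightarrow> lform x y \<in> carrier S"
  using lform_surj by auto

lemma rform_closed: "x \<in> X \<Longrightarrow> y \<in> X \<Longrightarrow> rform x y \<in> carrier T"
  using rform_surj by auto

text \<open>Unitality is not an axiom of the actions; it follows from \<open>lform_self\<close>,
  since \<open>x\<close> equals \<open>lact (lform x x) x\<close> and the identity is absorbed into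
  \<open>lform x x\<close>.\<close>

lemma lact_one: "x \<in> X \<Longrightarrow> lact \<one>\<^bsub>S\<^esub> x = x"
  by (metis lform_closed lform_self lact_mult S.l_one S.one_closed)

lemma ract_one: "x \<in> X \<Longrightarrow> ract x \<one>\<^bsub>T\<^esub> = x"
  by (metis rform_closed rform_self ract_mult T.r_one T.one_closed)

lemma one_eq_lform:
  obtains a b where "a \<in> X" "b \<in> X" "lform a b = \<one>\<^bsub>S\<^esub>"
proof -
  have "\<one>\<^bsub>S\<^esub> \<in> (\<lambda>(x, y). lform x y) ` (X \<times> X)"
    by (simp add: lform_surj)
  then show thesis
    using that by force
qed

lemma one_eq_rform:
  obtains p q where "p \<in> X" "q \<in> X" "rform p q = \<one>\<^bsub>T\<^esub>"
proof -
  have "\<one>\<^bsub>T\<^esub> \<in> (\<lambda>(x, y). rform x y) ` (X \<times> X)"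
    by (simp add: rform_surj)
  then show thesis
    using that by force
qed

text \<open>If \<langle>a, b\<rangle> = 1, then s = s \<langle>a, b\<rangle> = \<langle>s a,
  b\<rangle>, so the single value s a already determines s.\<close>

lemma lact_faithful:
  assumes "s \<in> carrier S" "s' \<in> carrier S" "\<And>x. x \<in> X \<Longrightarrow> lact s x = lact s' x"
  shows "s = s'"
proof -
  obtain a b where "a \<in> X" "b \<in> X" "lform a b = \<one>\<^bsub>S\<^esub>"
    by (rule one_eq_lform)
  then show ?thesis
    using assms by (metis lform_lact S.r_one)
qed

lemma ract_faithful:
  assumes "t \<in> carrier T" "t' \<in> carrier T" "\<And>x. x \<in> X \<Longrightarrow> ract x t = ract x t'"
  shows "t = t'"
proof -
  obtain p q where "p \<in> X" "q \<in> X" "rform p q = \<one>\<^bsub>T\<^esub>"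
    by (rule one_eq_rform)
  then show ?thesis
    using assms by (metis rform_ract T.l_one)
qed

text \<open>A relation instead of a map: it treats both sides alike and does not depend on how the
  identities are written as values of the forms.\<close>

definition matched :: "'a \<Rightarrow> 'b \<Rightarrow> bool" where
  "matched z t \<longleftrightarrow> z \<in> carrier S \<and> t \<in> carrier T \<and> (\<forall>x\<in>X. lact z x = ract x t)"

lemma matched_unique_right: "matched z t \<Longrightarrow> matched z t' \<Longrightarrow> t = t'"
  unfolding matched_def by (metis ract_faithful)

lemma matched_unique_left: "matched z t \<Longrightarrow> matched z' t \<Longrightarrow> z = z'"
  unfolding matched_def by (metis lact_faithful)

text \<open>Acting by \<open>z\<close> is the same as acting by \<open>t\<close> from the right, and
  this commutes with every left action; faithfulness turns that into centrality.\<close>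

lemma matched_center_left:
  assumes "matched z t"
  shows "z \<in> center S"
proof -
  have "z \<otimes>\<^bsub>S\<^esub> s = s \<otimes>\<^bsub>S\<^esub> z" if "s \<in> carrier S" for s
  proof (rule lact_faithful)
    fix x assume x: "x \<in> X"
    have "lact z (lact s x) = ract (lact s x) t"
      using assms x that by (simp add: matched_def lact_closed)
    also have "\<dots> = lact s (ract x t)"
      using assms x that by (simp add: matched_def acts_commute)
    also have "\<dots> = lact s (lact z x)"
      using assms x by (simp add: matched_def)
    finally show "lact (z \<otimes>\<^bsub>S\<^esub> s) x = lact (s \<otimes>\<^bsub>S\<^esub> z) x"
      using assms x that by (simp add: matched_def lact_mult)
  qed (use assms that in \<open>simp_all add: matched_def\<close>)
  then show ?thesis
    using assms by (simp add: center_def matched_def)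
qed

lemma matched_center_right:
  assumes "matched z t"
  shows "t \<in> center T"
proof -
  have "t \<otimes>\<^bsub>T\<^esub> s = s \<otimes>\<^bsub>T\<^esub> t" if "s \<in> carrier T" for s
  proof (rule ract_faithful)
    fix x assume x: "x \<in> X"
    have "ract (ract x t) s = ract (lact z x) s"
      using assms x by (simp add: matched_def)
    also have "\<dots> = lact z (ract x s)"
      using assms x that by (intro acts_commute) (simp_all add: matched_def)
    also have "\<dots> = ract (ract x s) t"
      using assms x that by (simp add: matched_def ract_closed)
    finally show "ract x (t \<otimes>\<^bsub>T\<^esub> s) = ract x (s \<otimes>\<^bsub>T\<^esub> t)"
      using assms x that by (simp add: matched_def ract_mult)
  qed (use assms that in \<open>simp_all add: matched_def\<close>)
  then show ?thesis
    using assms by (simp add: center_def matched_def)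
qed

text \<open>Since the two actions commute, z (z' x) = z (x t') = (z x) t' = x t t'. The order of the
  factors is therefore kept, and matching is not an anti-homomorphism.\<close>

lemma matched_mult:
  assumes "matched z t" "matched z' t'"
  shows "matched (z \<otimes>\<^bsub>S\<^esub> z') (t \<otimes>\<^bsub>T\<^esub> t')"
proof -
  have carr: "z \<in> carrier S" "z' \<in> carrier S" "t \<in> carrier T" "t' \<in> carrier T"
    using assms by (simp_all add: matched_def)
  have "lact (z \<otimes>\<^bsub>S\<^esub> z') x = ract x (t \<otimes>\<^bsub>T\<^esub> t')" if x: "x \<in> X" for x
  proof -
    have "lact (z \<otimes>\<^bsub>S\<^esub> z') x = lact z (ract x t')"
      using assms(2) carr x by (simp add: matched_def lact_mult)
    also have "\<dots> = ract (lact z x) t'"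
      using carr x by (simp add: acts_commute)
    also have "\<dots> = ract x (t \<otimes>\<^bsub>T\<^esub> t')"
      using assms(1) carr x by (simp add: matched_def ract_mult)
    finally show ?thesis .
  qed
  then show ?thesis
    using carr by (simp add: matched_def)
qed

lemma center_matched_right:
  assumes "z \<in> center S"
  shows "\<exists>t. matched z t"
proof -
  have z: "z \<in> carrier S" and comm: "\<And>s. s \<in> carrier S \<Longrightarrow> z \<otimes>\<^bsub>S\<^esub> s = s \<otimes>\<^bsub>S\<^esub> z"
    using assms by (auto simp: center_def)
  obtain p q where pq: "p \<in> X" "q \<in> X" "rform p q = \<one>\<^bsub>T\<^esub>"
    by (rule one_eq_rform)
  have "lact z x = ract x (rform p (lact z q))" if x: "x \<in> X" for x
  proof -
    have "ract x (rform p (lact z q)) = lact (lform x p) (lact z q)"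
      using x pq z by (simp add: forms_compat lact_closed)
    \<comment> \<open>Here the centrality of \<open>z\<close> is used, to move it past
      \<open>lform x p\<close>.\<close>
    also have "\<dots> = lact z (lact (lform x p) q)"
      using x pq z by (simp add: lform_closed comm flip: lact_mult)
    also have "\<dots> = lact z x"
      using x pq by (simp add: forms_compat ract_one)
    finally show ?thesis ..
  qed
  then have "matched z (rform p (lact z q))"
    unfolding matched_def using pq z by (intro conjI ballI rform_closed lact_closed)
  then show ?thesis ..
qed

lemma center_matched_left:
  assumes "t \<in> center T"
  shows "\<exists>z. matched z t"
proof -
  have t: "t \<in> carrier T" and comm: "\<And>s. s \<in> carrier T \<Longrightarrow> t \<otimes>\<^bsub>T\<^esub> s = s \<otimes>\<^bsub>T\<^esub> t"
    using assms by (auto simp: center_def)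
  obtain a b where ab: "a \<in> X" "b \<in> X" "lform a b = \<one>\<^bsub>S\<^esub>"
    by (rule one_eq_lform)
  \<comment> \<open>The chain is \<langle>a t, b\<rangle> x = a t [b, x] = a [b, x] t = \<langle>a,
    b\<rangle> x t = x t; its second equality is the centrality of \<open>t\<close>.\<close>
  have "lact (lform (ract a t) b) x = ract x t" if x: "x \<in> X" for x
  proof -
    have "lact (lform (ract a t) b) x = ract (ract a t) (rform b x)"
      using x ab t by (simp add: forms_compat ract_closed)
    also have "\<dots> = ract (ract a (rform b x)) t"
      using x ab t by (simp add: rform_closed comm flip: ract_mult)
    also have "\<dots> = ract x t"
      using x ab by (simp add: lact_one flip: forms_compat)
    finally show ?thesis .
  qed
  then have "matched (lform (ract a t) b) t"
    using ab t by (simp add: matched_def lform_closed ract_closed)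
  then show ?thesis ..
qed

lemma center_iso: "S\<lparr>carrier := center S\<rparr> \<cong> T\<lparr>carrier := center T\<rparr>"
proof -
  obtain f where f: "\<And>z. z \<in> center S \<Longrightarrow> matched z (f z)"
    using center_matched_right by metis
  \<comment> \<open>A product of matched elements is again matched, hence central.\<close>
  have center_mult: "z \<otimes>\<^bsub>S\<^esub> z' \<in> center S" if "z \<in> center S" "z' \<in> center S" for z z'
    using that by (blast intro: matched_mult matched_center_left f)
  have "f \<in> hom (S\<lparr>carrier := center S\<rparr>) (T\<lparr>carrier := center T\<rparr>)"
  proof (rule homI)
    fix z z' assume "z \<in> carrier (S\<lparr>carrier := center S\<rparr>)" "z' \<in> carrier (S\<lparr>carrier := center S\<rparr>)"
    then show "f (z \<otimes>\<^bsub>S\<lparr>carrier := center S\<rparr>\<^esub> z') = f z \<otimes>\<^bsub>T\<lparr>carrier := center T\<rparr>\<^esub> f z'"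
      \<comment> \<open>Both sides are matched with the product of \<open>z\<close> and
        \<open>z'\<close>, so they agree.\<close>
      by simp (intro matched_unique_right[OF f matched_mult[OF f f]] center_mult)
  qed (auto intro: matched_center_right f)
  moreover have "bij_betw f (center S) (center T)"
  proof (rule bij_betw_imageI)
    show "inj_on f (center S)"
      by (rule inj_onI) (metis f matched_unique_left)
    show "f ` center S = center T"
    proof
      show "f ` center S \<subseteq> center T"
        using f matched_center_right by blast
      \<comment> \<open>A central \<open>t\<close> is matched with some \<open>z\<close>, which is
        then central itself; uniqueness gives \<open>f z = t\<close>.\<close>
      show "center T \<subseteq> f ` center S"
        by (metis center_matched_left f image_eqI matched_center_left matched_unique_right subsetI)
    qed
  qed
  ultimately show ?thesis
    by (auto simp: is_iso_def iso_def)
qed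

end

theorem proposition5p8:
  fixes S :: "('a, 'm) monoid_scheme" and T :: "('b, 'n) monoid_scheme"
  assumes "inverse_monoid S" and "inverse_monoid T"
    and "strongly_morita_equivalent TYPE('x) S T"
  shows "S\<lparr>carrier := center S\<rparr> \<cong> T\<lparr>carrier := center T\<rparr>"
proof -
  obtain X :: "'x set" and lact ract lform rform
    where "morita_context S T X lact ract lform rform"
    using assms(3) by (auto simp: strongly_morita_equivalent_def)
  then interpret monoid_morita_context S T X lact ract lform rform
    using assms(1,2) by (simp add: monoid_morita_context_def inverse_monoid_def)
  show ?thesis
    by (rule center_iso)
qed

end
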